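(* Let $\chi,\mu$ be probability measures on $\mathbb{R}$, $\ddot\mu$ a symmetrization of $\mu$, and $\mathfrak{D}(\cdot,m)$ the associated deconvolution function. Assume that there exists $\tau>0$ with $\int_0^\tau t^{-1}(1-\Phi_{\ddot\mu}(t))\,dt<\infty$, and that there exists $T_{\ddot\mu}>0$ with $\Phi_{\ddot\mu}(t)=0$ for all $|t|>T_{\ddot\mu}$. Define $$\Theta(t) := \frac{\Phi_\chi(t)}{2\pi i t}\,\mathbf{1}_{[-T_{\ddot\mu},T_{\ddot\mu}]\cap\mathcal{N}_\mu}(t).$$ Then, for every $\xi\in\mathbb{R}$, $$\lim_{m\to\infty}\frac{\mathfrak{D}(\xi,m)+\mathfrak{D}(\xi-,m)}{2} = \frac{F_\chi(\xi)+F_\chi(\xi-)}{2} + \mathcal{F}\{\Theta\}(-\xi) + \mathcal{F}\{\Psi_{T_{\ddot\mu},\infty}\}(-\xi).$$ In particular, the second and the third summand on the right-hand side are uniformly bounded with respect to $\xi$ in any compact subset of $\mathbb{R}$.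
   Context: Measures are finite signed Borel measures on $\mathbb{R}$. $F_\nu(\xi) := \nu((-\infty,\xi])$, $\Phi_\nu(t) := \int e^{itx}\,\nu(dx)$, and $\mathcal{N}_\nu := \{t \in \mathbb{R}\cup\{\pm\infty\} : \Phi_\nu(t)=0\}$, where $\pm\infty \in \mathcal{N}_\nu$ means $\lim_{t\to\pm\infty}\Phi_\nu(t)=0$. $Q(\xi-)$ denotes the left limit of $Q$ at $\xi$. $\nu^{*0}:=\delta_{\{0\}}$, $\nu^{*k} := \nu * \nu^{*(k-1)}$, and $F_\nu^{*k}$ is the distribution function of $\nu^{*k}$. A symmetrization of $\mu$ is a probability measure $\ddot\mu = \mu*\eta$, with $\eta$ a probability measure, such that $F_{\ddot\mu}(\xi-)=1-F_{\ddot\mu}(-\xi)$ for all $\xi$, $\Phi_{\ddot\mu}=\Phi_\mu\Phi_\eta$ is even with $0\le\Phi_{\ddot\mu}\le1$, and $\mathcal{N}_{\ddot\mu}=\mathcal{N}_\mu$. Put $\pi_{\ddot\mu} := \delta_{\{0\}} - \ddot\mu$, $\mathfrak{K}_{\ddot\mu}(\xi,m) := \sum_{\ell=0}^m F_{\pi_{\ddot\mu}}^{*\ell}(\xi)$. The deconvolution function is $\mathfrak{D}(\xi,m) := \int_{\mathbb{R}} F_{\chi*\ddot\mu}(\xi-x)\,\mathfrak{K}_{\ddot\mu}(dx,m)$, for $(\xi,m)\in\mathbb{R}\times\mathbb{N}_0$. $\mathcal{F}\{q\}(t) := \int_{-\infty}^\infty e^{itx}q(x)\,dx$. For $S>0$,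 $\mathcal{F}\{\Psi_{S,\infty}\}(-\xi)$ denotes $\lim_{T\to\infty}\int_{S\le|t|\le T} e^{-i\xi t}\frac{\Phi_\chi(t)}{2\pi i t}\,dt$, which equals $$\frac{1-F_\chi(\xi)-F_\chi(\xi-)}{2}+\frac1\pi\int_{-\infty}^\infty \operatorname{Si}((\xi-x)S)\,F_\chi(dx),\qquad \operatorname{Si}(y):=\int_0^y\frac{\sin t}{t}\,dt.$$ *)

theory Defs
  imports "HOL-Probability.Probability"
begin

section \<open>Finite signed Borel measures on the real line\<close>

text \<open>
  A finite signed Borel measure is represented by its set function, of which only the values on
  Borel sets matter.  A finite Borel measure \<open>M\<close> is thus the signed measure \<open>measure M\<close>, and
  sums and differences of signed measures are taken setwise.  By the Jordan decomposition the
  finite signed Borel measures are exactly the differences of two finite Borel measures.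
\<close>

definition signed_decomp :: "(real set \<Rightarrow> real) \<Rightarrow> real measure \<Rightarrow> real measure \<Rightarrow> bool" where
  "signed_decomp \<nu> P N \<longleftrightarrow> finite_borel_measure P \<and> finite_borel_measure N \<and>
     (\<forall>A\<in>sets borel. \<nu> A = measure P A - measure N A)"

text \<open>
  The integral of a bounded Borel function does not depend on the decomposition;
  see \<open>signed_integral_eq\<close> below.
\<close>

definition signed_integral :: "(real set \<Rightarrow> real) \<Rightarrow> (real \<Rightarrow> real) \<Rightarrow> real" where
  "signed_integral \<nu> f =
     (THE I. \<exists>P N. signed_decomp \<nu> P N \<and> I = (LINT x|P. f x) - (LINT x|N. f x))"

definition signed_cdf :: "(real set \<Rightarrow> real) \<Rightarrow> real \<Rightarrow> real" where
  "signed_cdf \<nu> \<xi> = \<nu> {..\<xi>}"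

text \<open>\<open>(\<nu> * \<rho>)(A) = \<integral> \<rho>(A - x) \<nu>(dx)\<close>\<close>

definition signed_convolution ::
    "(real set \<Rightarrow> real) \<Rightarrow> (real set \<Rightarrow> real) \<Rightarrow> real set \<Rightarrow> real" where
  "signed_convolution \<nu> \<rho> A = signed_integral \<nu> (\<lambda>x. \<rho> {y. x + y \<in> A})"

fun convolution_power :: "(real set \<Rightarrow> real) \<Rightarrow> nat \<Rightarrow> real set \<Rightarrow> real" where
  "convolution_power \<nu> 0 = measure (return borel 0)"
| "convolution_power \<nu> (Suc k) = signed_convolution \<nu> (convolution_power \<nu> k)"

lemma signed_decomp_nn_integral_eq:
  assumes "signed_decomp \<nu> P N" "signed_decomp \<nu> P' N'" and f: "f \<in> borel_measurable borel"
  shows "(\<integral>\<^sup>+x. f x \<partial>P) + (\<integral>\<^sup>+x. f x \<partial>N') = (\<integral>\<^sup>+x. f x \<partial>P') + (\<integral>\<^sup>+x. f x \<partial>N)"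
proof -
  interpret P: finite_borel_measure P using assms by (simp add: signed_decomp_def)
  interpret N: finite_borel_measure N using assms by (simp add: signed_decomp_def)
  interpret P': finite_borel_measure P' using assms by (simp add: signed_decomp_def)
  interpret N': finite_borel_measure N' using assms by (simp add: signed_decomp_def)
  note [measurable_cong] = P.M_is_borel N.M_is_borel P'.M_is_borel N'.M_is_borel
  note sp = P.borel_UNIV N.borel_UNIV P'.borel_UNIV N'.borel_UNIV
  show ?thesis using f
  proof (induction rule: borel_measurable_induct)
    case (cong f g)
    have "f = g" using cong.hyps(3) by (intro ext) simp
    then show ?case using cong.IH by simp
  next
    case (set A)
    have [measurable]: "A \<in> sets borel" using set by simp
    have "measure P A - measure N A = measure P' A - measure N' A"
      using assms(1,2) set by (simp add: signed_decomp_def)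
    then have "measure P A + measure N' A = measure P' A + measure N A" by linarith
    then show ?case
      by (simp add: P.emeasure_eq_measure N.emeasure_eq_measure P'.emeasure_eq_measure
          N'.emeasure_eq_measure flip: ennreal_plus)
  next
    case (mult u c)
    note [measurable] = mult.hyps(2)
    show ?case using mult.IH by (simp add: nn_integral_cmult flip: distrib_left)
  next
    case (add u v)
    note [measurable] = add.hyps(1,3)
    show ?case using add.IH by (simp add: nn_integral_add) (metis (no_types) add.assoc add.left_commute)
  next
    case (seq U)
    note [measurable] = seq.hyps(1)
    have mono: "(SUP i. \<integral>\<^sup>+x. U i x \<partial>M) + (SUP i. \<integral>\<^sup>+x. U i x \<partial>M')
        = (SUP i. (\<integral>\<^sup>+x. U i x \<partial>M) + (\<integral>\<^sup>+x. U i x \<partial>M'))" for M M' :: "real measure"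
      using seq.hyps(3)
      by (intro ennreal_SUP_add[symmetric]) (auto simp: incseq_def le_fun_def intro!: nn_integral_mono)
    show ?case
      using seq.hyps(3) seq.IH unfolding SUP_apply
      by (simp add: nn_integral_monotone_convergence_SUP mono)
  qed
qed

lemma signed_integral_eq:
  assumes dec: "signed_decomp \<nu> P N"
    and f [measurable]: "f \<in> borel_measurable borel" and bdd: "\<And>x. \<bar>f x\<bar> \<le> B"
  shows "signed_integral \<nu> f = (LINT x|P. f x) - (LINT x|N. f x)"
  unfolding signed_integral_def
proof (rule the_equality)
  fix I assume "\<exists>P N. signed_decomp \<nu> P N \<and> I = (LINT x|P. f x) - (LINT x|N. f x)"
  then obtain P' N' where dec': "signed_decomp \<nu> P' N'"
    and I: "I = (LINT x|P'. f x) - (LINT x|N'. f x)" by blast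
  let ?g = "\<lambda>x. f x + B"
  have B: "0 \<le> ?g x" for x using bdd[of x] by linarith
  have int: "integrable M f" "integrable M (\<lambda>x. B)" if "finite_borel_measure M" for M
  proof -
    interpret finite_borel_measure M by fact
    note [measurable_cong] = M_is_borel
    show "integrable M f"
      by (rule integrable_const_bound[where B = B]) (use bdd in auto)
    show "integrable M (\<lambda>x. B)" by simp
  qed
  have nn: "(\<integral>\<^sup>+x. ennreal (?g x) \<partial>M) = ennreal (LINT x|M. ?g x)" if "finite_borel_measure M" for M
    using int[OF that] B by (intro nn_integral_eq_integral) auto
  have fin: "finite_borel_measure P" "finite_borel_measure N"
      "finite_borel_measure P'" "finite_borel_measure N'"
    using dec dec' by (auto simp: signed_decomp_def)
  have "(LINT x|P. ?g x) + (LINT x|N'. ?g x) = (LINT x|P'. ?g x) + (LINT x|N. ?g x)"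
    using signed_decomp_nn_integral_eq[OF dec dec', of "\<lambda>x. ennreal (?g x)"] B
    by (simp add: nn fin integral_nonneg flip: ennreal_plus)
  moreover have "(LINT x|M. ?g x) = (LINT x|M. f x) + B * measure M UNIV"
    if "finite_borel_measure M" for M
    using int[OF that] finite_borel_measure.borel_UNIV[OF that] by simp
  moreover have "measure P UNIV - measure N UNIV = measure P' UNIV - measure N' UNIV"
  proof -
    have "\<nu> UNIV = measure P UNIV - measure N UNIV" "\<nu> UNIV = measure P' UNIV - measure N' UNIV"
      using dec dec' by (auto simp: signed_decomp_def)
    then show ?thesis by simp
  qed
  then have "B * measure P UNIV - B * measure N UNIV = B * measure P' UNIV - B * measure N' UNIV"
    by (metis right_diff_distrib)
  ultimately show "I = (LINT x|P. f x) - (LINT x|N. f x)"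
    using fin unfolding I by (simp add: fin)
qed (use dec in blast)

lemma signed_decomp_measure:
  assumes "finite_borel_measure M"
  shows "signed_decomp (measure M) M (null_measure borel)"
  using assms
  by (auto simp: signed_decomp_def finite_borel_measure_def finite_borel_measure_axioms_def
      measure_def intro!: finite_measureI)

lemma signed_convolution_measure:
  assumes "finite_borel_measure M" "finite_borel_measure N" and A [measurable]: "A \<in> sets borel"
  shows "signed_convolution (measure M) (measure N) A = measure (M \<star> N) A"
proof -
  interpret M: finite_borel_measure M by fact
  interpret N: finite_borel_measure N by fact
  note [measurable_cong] = M.M_is_borel N.M_is_borel
  have sp: "space M = UNIV" "space N = UNIV" by (auto simp: M.borel_UNIV N.borel_UNIV)
  have nneq: "emeasure (M \<star> N) A = (\<integral>\<^sup>+x. emeasure N {y. x + y \<in> A} \<partial>M)"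
    using convolution_emeasure[OF A] M.finite_measure_axioms N.finite_measure_axioms sp
    by (simp add: M.M_is_borel N.M_is_borel add.commute)
  have "{p. fst p + snd p \<in> A} \<in> sets (borel \<Otimes>\<^sub>M N)"
    using measurable_sets[of "\<lambda>p. fst p + snd p :: real" "borel \<Otimes>\<^sub>M N" borel A]
    by (simp add: vimage_def space_pair_measure sp)
  then have "(\<lambda>x. measure N (Pair x -` {p. fst p + snd p \<in> A})) \<in> borel_measurable borel"
    unfolding measure_def by (intro measurable_compose[OF N.measurable_emeasure_Pair]) auto
  then have meas [measurable]: "(\<lambda>x. measure N {y. x + y \<in> A}) \<in> borel_measurable borel"
    by (simp add: vimage_def)
  have "signed_convolution (measure M) (measure N) A = (LINT x|M. measure N {y. x + y \<in> A})"
    unfolding signed_convolution_def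
    by (subst signed_integral_eq[OF signed_decomp_measure[OF assms(1)], where B = "measure N UNIV"])
       (use N.bounded_measure in \<open>auto simp: sp integral_null_measure\<close>)
  also have "\<dots> = measure (M \<star> N) A"
    unfolding measure_def[of "M \<star> N"] nneq
    by (subst integral_eq_nn_integral) (auto simp: N.emeasure_eq_measure)
  finally show ?thesis .
qed


section \<open>Left limits, zeros of characteristic functions, symmetrization\<close>

definition left_lim :: "(real \<Rightarrow> real) \<Rightarrow> real \<Rightarrow> real" where
  "left_lim Q \<xi> = Lim (at_left \<xi>) Q"

definition char_zeros :: "real measure \<Rightarrow> ereal set" where
  "char_zeros \<nu> = {ereal t | t. char \<nu> t = 0}
     \<union> {t. t = \<infinity> \<and> (char \<nu> \<longlongrightarrow> 0) at_top}
     \<union> {t. t = -\<infinity> \<and> (char \<nu> \<longlongrightarrow> 0) at_bot}"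

definition symmetrization :: "real measure \<Rightarrow> real measure \<Rightarrow> bool" where
  "symmetrization \<mu>s \<mu> \<longleftrightarrow>
     (\<exists>\<eta>. real_distribution \<eta> \<and> \<mu>s = (\<mu> \<star> \<eta>) \<and> (\<forall>t. char \<mu>s t = char \<mu> t * char \<eta> t)) \<and>
     real_distribution \<mu>s \<and>
     (\<forall>\<xi>. left_lim (cdf \<mu>s) \<xi> = 1 - cdf \<mu>s (-\<xi>)) \<and>
     (\<forall>t. char \<mu>s (-t) = char \<mu>s t) \<and>
     (\<forall>t. \<exists>r. char \<mu>s t = complex_of_real r \<and> 0 \<le> r \<and> r \<le> 1) \<and>
     char_zeros \<mu>s = char_zeros \<mu>"


section \<open>The deconvolution function\<close>

definition pi_measure :: "real measure \<Rightarrow> real set \<Rightarrow> real" where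
  "pi_measure \<mu>s A = measure (return borel 0) A - measure \<mu>s A"

definition deconv_kernel :: "real measure \<Rightarrow> real \<Rightarrow> nat \<Rightarrow> real" where
  "deconv_kernel \<mu>s \<xi> m = (\<Sum>l\<le>m. signed_cdf (convolution_power (pi_measure \<mu>s) l) \<xi>)"

text \<open>The signed measure with distribution function \<open>\<lambda>\<xi>. deconv_kernel \<mu>s \<xi> m\<close>.\<close>

definition deconv_kernel_measure :: "real measure \<Rightarrow> nat \<Rightarrow> real set \<Rightarrow> real" where
  "deconv_kernel_measure \<mu>s m A = (\<Sum>l\<le>m. convolution_power (pi_measure \<mu>s) l A)"

lemma signed_cdf_deconv_kernel_measure:
  "signed_cdf (deconv_kernel_measure \<mu>s m) \<xi> = deconv_kernel \<mu>s \<xi> m"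
  by (simp add: signed_cdf_def deconv_kernel_measure_def deconv_kernel_def)

definition deconv_fun :: "real measure \<Rightarrow> real measure \<Rightarrow> real \<Rightarrow> nat \<Rightarrow> real" where
  "deconv_fun chi \<mu>s \<xi> m =
     signed_integral (deconv_kernel_measure \<mu>s m) (\<lambda>x. cdf (chi \<star> \<mu>s) (\<xi> - x))"


section \<open>Fourier transforms\<close>

definition fourier :: "(real \<Rightarrow> complex) \<Rightarrow> real \<Rightarrow> complex" where
  "fourier q t = (CLBINT x. iexp (t * x) * q x)"

definition Theta :: "real measure \<Rightarrow> real measure \<Rightarrow> real \<Rightarrow> real \<Rightarrow> complex" where
  "Theta chi \<mu> T t = char chi t / (2 * complex_of_real pi * \<i> * complex_of_real t)
     * indicator {t. t \<in> {-T..T} \<and> ereal t \<in> char_zeros \<mu>} t"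

definition Psi :: "real measure \<Rightarrow> real \<Rightarrow> real \<Rightarrow> real \<Rightarrow> complex" where
  "Psi chi S T t = char chi t / (2 * complex_of_real pi * \<i> * complex_of_real t)
     * indicator {t. S \<le> \<bar>t\<bar> \<and> \<bar>t\<bar> \<le> T} t"

text \<open>The transform at \<open>T = \<infinity>\<close> is an improper integral; the integrand need not be integrable.\<close>

definition fourier_Psi_inf :: "real measure \<Rightarrow> real \<Rightarrow> real \<Rightarrow> complex" where
  "fourier_Psi_inf chi S s = Lim at_top (\<lambda>T. fourier (Psi chi S T) s)"

end

theory Submission
  imports Defs
begin

text \<open>
  Write \<open>\<pi> = \<delta>\<^sub>0 - \<mu>s\<close> and \<open>p = 1 - char \<mu>s\<close>, a function with values in \<open>[0, 1]\<close>.  Convolving the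
  geometric sum \<open>\<Sum>l\<le>m. \<pi>\<^sup>l\<close> with \<open>\<mu>s = \<delta>\<^sub>0 - \<pi>\<close> telescopes, so the deconvolution function is the
  distribution function of \<open>chi - chi \<star> \<pi>\<^sup>m\<^sup>+\<^sup>1\<close> (\<open>deconv_fun_telescope\<close>).  The correction
  \<open>chi \<star> \<pi>\<^sup>m\<^sup>+\<^sup>1\<close> has total mass \<open>0\<close> and characteristic function \<open>char chi \<cdot> p\<^sup>m\<^sup>+\<^sup>1\<close>.

  The inversion formula of Gil-Pelaez recovers the mean of a distribution function and its left
  limit from the integral of \<open>iexp (- \<xi> t) \<cdot> char M t / (2 pi \<i> t)\<close>, taken in the principal value
  sense at \<open>0\<close> and at infinity.  It is proved for finite measures: by Fubini, the truncated integral
  is an integral of the sine integral function (\<open>fourier_Psi_eq_sine_transform\<close>), which,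
  divided by \<open>pi\<close>, converges boundedly to half of the sign function (\<open>sine_transform_tendsto\<close>).  The correction is
  a difference of two finite measures.  Its characteristic function divided by \<open>t\<close> is integrable
  near \<open>0\<close>, because \<open>p\<^sup>m\<^sup>+\<^sup>1 \<le> p\<close> and \<open>p t / t\<close> is integrable there, and outside of \<open>[-T, T]\<close> it
  coincides with \<open>char chi / t\<close>, because \<open>p = 1\<close> there (\<open>mid_cdf_difference_inversion\<close>).

  Only the integral over \<open>[-T, T]\<close> depends on \<open>m\<close>.  As \<open>p\<^sup>m\<^sup>+\<^sup>1\<close> decreases to the indicator of the set
  where \<open>char \<mu>s\<close>, equivalently \<open>char \<mu>\<close>, vanishes, dominated convergence with majorant
  \<open>p t / \<bar>t\<bar>\<close> turns this integral into the transform of \<open>Theta\<close>.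
\<close>

section \<open>Sums of finite Borel measures\<close>

text \<open>
  Convolving with \<open>\<delta>\<^sub>0 - \<mu>s\<close> maps a pair of positive and negative parts to a pair of sums, so
  explicit decompositions of convolution powers require the sum of two measures.
\<close>

definition add_measure :: "real measure \<Rightarrow> real measure \<Rightarrow> real measure" (infixl \<open>\<oplus>\<^sub>m\<close> 65) where
  "M \<oplus>\<^sub>m N = measure_of UNIV (sets borel) (\<lambda>A. emeasure M A + emeasure N A)"

lemma sets_add_measure [simp]: "sets (M \<oplus>\<^sub>m N) = sets borel"
  and space_add_measure [simp]: "space (M \<oplus>\<^sub>m N) = UNIV"
  using sets.sigma_sets_eq[of "borel :: real measure"] by (simp_all add: add_measure_def)

lemma emeasure_add_measure:
  assumes M: "sets M = sets borel" and N: "sets N = sets borel" and A: "A \<in> sets borel"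
  shows "emeasure (M \<oplus>\<^sub>m N) A = emeasure M A + emeasure N A"
proof (rule emeasure_measure_of[OF add_measure_def])
  show "countably_additive (sets (M \<oplus>\<^sub>m N)) (\<lambda>A. emeasure M A + emeasure N A)"
    unfolding countably_additive_def
  proof (intro allI impI)
    fix A :: "nat \<Rightarrow> real set"
    assume A: "range A \<subseteq> sets (M \<oplus>\<^sub>m N)" "disjoint_family A"
    then show "(\<Sum>i. emeasure M (A i) + emeasure N (A i)) = emeasure M (\<Union>i. A i) + emeasure N (\<Union>i. A i)"
      using M N by (simp add: suminf_add[symmetric] suminf_emeasure)
  qed
qed (use A in \<open>auto simp: positive_def\<close>)

lemma finite_borel_measure_add_measure:
  assumes "finite_borel_measure M" "finite_borel_measure N"
  shows "finite_borel_measure (M \<oplus>\<^sub>m N)"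
proof -
  interpret M: finite_borel_measure M by fact
  interpret N: finite_borel_measure N by fact
  show ?thesis
    unfolding finite_borel_measure_def finite_borel_measure_axioms_def
    by (auto intro!: finite_measureI simp: emeasure_add_measure M.M_is_borel N.M_is_borel
        M.emeasure_eq_measure N.emeasure_eq_measure)
qed

lemma measure_add_measure:
  assumes "finite_borel_measure M" "finite_borel_measure N" "A \<in> sets borel"
  shows "measure (M \<oplus>\<^sub>m N) A = measure M A + measure N A"
proof -
  interpret M: finite_borel_measure M by fact
  interpret N: finite_borel_measure N by fact
  interpret S: finite_borel_measure "M \<oplus>\<^sub>m N"
    using assms by (intro finite_borel_measure_add_measure)
  have "ennreal (measure (M \<oplus>\<^sub>m N) A) = ennreal (measure M A + measure N A)"
    using emeasure_add_measure[OF M.M_is_borel N.M_is_borel assms(3)]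
    by (simp add: S.emeasure_eq_measure M.emeasure_eq_measure N.emeasure_eq_measure)
  then show ?thesis by (subst (asm) ennreal_inj) auto
qed

lemma integrable_finite_borel_measure:
  fixes f :: "real \<Rightarrow> 'b::{banach, second_countable_topology}"
  assumes "finite_borel_measure M" and f: "f \<in> borel_measurable borel"
    and bdd: "\<And>x. norm (f x) \<le> B"
  shows "integrable M f"
proof -
  interpret finite_borel_measure M by fact
  note [measurable_cong] = M_is_borel
  note [measurable] = f
  show ?thesis by (rule integrable_const_bound[where B = B]) (use bdd in auto)
qed

text \<open>
  The signed measure \<open>measure M\<close> is decomposed both by \<open>M\<close> alone and by \<open>M \<oplus>\<^sub>m N\<close> and \<open>N\<close>.  As its
  integral depends on neither choice, additivity in the measure follows without passing through
  simple functions.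
\<close>

lemma integral_add_measure_real:
  fixes f :: "real \<Rightarrow> real"
  assumes M: "finite_borel_measure M" and N: "finite_borel_measure N"
    and f: "f \<in> borel_measurable borel" and bdd: "\<And>x. \<bar>f x\<bar> \<le> B"
  shows "(LINT x|(M \<oplus>\<^sub>m N). f x) = (LINT x|M. f x) + (LINT x|N. f x)"
proof -
  have "signed_decomp (measure M) (M \<oplus>\<^sub>m N) N"
    using M N by (simp add: signed_decomp_def finite_borel_measure_add_measure measure_add_measure)
  from signed_integral_eq[OF this f bdd] signed_integral_eq[OF signed_decomp_measure[OF M] f bdd]
  show ?thesis by (simp add: integral_null_measure)
qed

lemma char_add_measure:
  assumes M: "finite_borel_measure M" and N: "finite_borel_measure N"
  shows "char (M \<oplus>\<^sub>m N) t = char M t + char N t"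
proof -
  have *: "char K t = complex_of_real (LINT x|K. cos (t * x)) + \<i> * complex_of_real (LINT x|K. sin (t * x))"
    if "finite_borel_measure K" for K
  proof -
    have "integrable K (\<lambda>x. iexp (t * x))"
      by (intro integrable_finite_borel_measure[OF that, where B = 1]) (auto simp del: of_real_mult)
    then show ?thesis
      by (simp add: char_def complex_eq_iff Re_exp Im_exp flip: integral_Re integral_Im)
  qed
  have "(LINT x|(M \<oplus>\<^sub>m N). cos (t * x)) = (LINT x|M. cos (t * x)) + (LINT x|N. cos (t * x))"
    "(LINT x|(M \<oplus>\<^sub>m N). sin (t * x)) = (LINT x|M. sin (t * x)) + (LINT x|N. sin (t * x))"
    by (rule integral_add_measure_real[OF M N, where B = 1]; simp)+
  then show ?thesis
    unfolding *[OF finite_borel_measure_add_measure[OF M N]] *[OF M] *[OF N]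
    by (simp add: distrib_left)
qed

section \<open>Convolution of finite Borel measures\<close>

lemma integral_convolution:
  fixes f :: "real \<Rightarrow> 'b::{banach, second_countable_topology}"
  assumes "finite_borel_measure M" "finite_borel_measure N"
    and f: "f \<in> borel_measurable borel" and bdd: "\<And>x. norm (f x) \<le> B"
  shows "(LINT z|(M \<star> N). f z) = (LINT x|M. LINT y|N. f (x + y))"
proof -
  interpret M: finite_borel_measure M by fact
  interpret N: finite_borel_measure N by fact
  interpret pair_sigma_finite M N ..
  interpret P: finite_measure "M \<Otimes>\<^sub>M N"
    by (intro finite_measure_pair_measure) unfold_locales
  note [measurable_cong] = M.M_is_borel N.M_is_borel
  note [measurable] = f
  have int: "integrable (M \<Otimes>\<^sub>M N) (\<lambda>(x, y). f (x + y))"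
    by (rule P.integrable_const_bound[where B = B]) (use bdd in auto)
  have "(LINT z|(M \<star> N). f z) = (LINT p|(M \<Otimes>\<^sub>M N). (\<lambda>(x, y). f (x + y)) p)"
    unfolding convolution_def by (subst integral_distr) (auto simp: case_prod_beta')
  also have "\<dots> = (LINT x|M. LINT y|N. f (x + y))"
    using integral_fst'[OF int] by simp
  finally show ?thesis .
qed

lemma finite_borel_measure_convolution:
  assumes "finite_borel_measure M" "finite_borel_measure N"
  shows "finite_borel_measure (M \<star> N)"
proof -
  interpret M: finite_borel_measure M by fact
  interpret N: finite_borel_measure N by fact
  have "finite_measure (M \<star> N)"
    by (intro convolution_finite M.M_is_borel N.M_is_borel) unfold_locales
  then show ?thesis
    by (simp add: finite_borel_measure_def finite_borel_measure_axioms_def)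
qed

lemma char_convolution:
  assumes M: "finite_borel_measure M" and N: "finite_borel_measure N"
  shows "char (M \<star> N) t = char M t * char N t"
proof -
  have "char (M \<star> N) t = (CLINT x|M. CLINT y|N. iexp (t * (x + y)))"
    unfolding char_def
    by (rule integral_convolution[OF M N, where B = 1]) (auto simp del: of_real_mult)
  also have "\<dots> = (CLINT x|M. CLINT y|N. iexp (t * x) * iexp (t * y))"
    by (simp add: distrib_left exp_add)
  finally show ?thesis by (simp add: char_def)
qed

lemma measure_convolution:
  assumes M: "finite_borel_measure M" and N: "finite_borel_measure N" and A: "A \<in> sets borel"
  shows "measure (M \<star> N) A = (LINT x|M. measure N {y. x + y \<in> A})"
proof -
  interpret M: finite_borel_measure M by fact
  interpret N: finite_borel_measure N by fact
  interpret C: finite_borel_measure "M \<star> N"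
    using M N by (rule finite_borel_measure_convolution)
  have [measurable]: "A \<in> sets borel" by fact
  have "measure (M \<star> N) A = (LINT z|(M \<star> N). indicator A z)"
    by (simp add: C.borel_UNIV)
  also have "\<dots> = (LINT x|M. LINT y|N. indicator A (x + y))"
    by (rule integral_convolution[OF M N, where B = 1]) (auto simp: indicator_def)
  also have "\<dots> = (LINT x|M. measure N {y. x + y \<in> A})"
  proof (rule Bochner_Integration.integral_cong[OF refl])
    fix x
    have "(\<lambda>y. indicator A (x + y) :: real) = indicator {y. x + y \<in> A}"
      by (auto simp: indicator_def)
    then show "(LINT y|N. indicator A (x + y)) = measure N {y. x + y \<in> A}"
      by (simp add: N.borel_UNIV)
  qed
  finally show ?thesis .
qed

lemma borel_measurable_measure_translate:
  assumes N: "finite_borel_measure N" and A: "A \<in> sets borel"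
  shows "(\<lambda>x::real. measure N {y. x + y \<in> A}) \<in> borel_measurable borel"
proof -
  interpret N: finite_borel_measure N by fact
  note [measurable_cong] = N.M_is_borel
  have [measurable]: "A \<in> sets borel" by fact
  have "{p :: real \<times> real. fst p + snd p \<in> A} \<in> sets (borel \<Otimes>\<^sub>M N)"
    using measurable_sets[of "\<lambda>p. fst p + snd p :: real" "borel \<Otimes>\<^sub>M N" borel A]
    by (simp add: vimage_def space_pair_measure N.borel_UNIV)
  then have "(\<lambda>x. measure N (Pair x -` {p :: real \<times> real. fst p + snd p \<in> A})) \<in> borel_measurable borel"
    unfolding measure_def by (intro measurable_compose[OF N.measurable_emeasure_Pair]) auto
  then show ?thesis by (simp add: vimage_def)
qed

lemma cdf_convolution:
  assumes M: "finite_borel_measure M" and N: "finite_borel_measure N"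
  shows "cdf (M \<star> N) \<xi> = (LINT x|M. cdf N (\<xi> - x))"
proof -
  have "{y. x + y \<le> \<xi>} = {..\<xi> - x}" for x by auto
  then show ?thesis
    using measure_convolution[OF M N, of "{..\<xi>}"] by (simp add: cdf_def)
qed

section \<open>Convolution powers of the signed measure and telescoping\<close>

lemma finite_borel_measure_return: "finite_borel_measure (return borel (a::real))"
  unfolding finite_borel_measure_def finite_borel_measure_axioms_def
  by (auto intro!: finite_measureI)

lemma signed_decomp_pi:
  assumes "finite_borel_measure \<mu>s"
  shows "signed_decomp (pi_measure \<mu>s) (return borel 0) \<mu>s"
proof -
  show ?thesis
    using assms by (simp add: signed_decomp_def pi_measure_def finite_borel_measure_return)
qed

lemma signed_decomp_pi_convolution:
  assumes \<mu>s: "finite_borel_measure \<mu>s" and dec: "signed_decomp \<nu> P N"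
  shows "signed_decomp (signed_convolution (pi_measure \<mu>s) \<nu>) (P \<oplus>\<^sub>m (\<mu>s \<star> N)) (N \<oplus>\<^sub>m (\<mu>s \<star> P))"
proof -
  have P: "finite_borel_measure P" and N: "finite_borel_measure N"
    and \<nu>: "\<And>A. A \<in> sets borel \<Longrightarrow> \<nu> A = measure P A - measure N A"
    using dec by (auto simp: signed_decomp_def)
  note fin = P N finite_borel_measure_convolution[OF \<mu>s P] finite_borel_measure_convolution[OF \<mu>s N]
  have "signed_convolution (pi_measure \<mu>s) \<nu> A
      = measure P A + measure (\<mu>s \<star> N) A - (measure N A + measure (\<mu>s \<star> P) A)"
    if A: "A \<in> sets borel" for A
  proof -
    have [measurable]: "A \<in> sets borel" by fact
    have shift: "{y. x + y \<in> A} \<in> sets borel" for x :: real by measurable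
    note meas = borel_measurable_measure_translate[OF _ A]
    have le: "measure M B \<le> measure M UNIV" if "finite_borel_measure M" for M B
      using finite_measure.bounded_measure[of M B] finite_borel_measure.borel_UNIV[OF that]
        that[unfolded finite_borel_measure_def] by simp
    have bdd: "\<bar>measure P B - measure N B\<bar> \<le> measure P UNIV + measure N UNIV" for B
      using le[OF P, of B] le[OF N, of B] measure_nonneg[of P B] measure_nonneg[of N B] by linarith
    have int: "integrable \<mu>s (\<lambda>x. measure M {y. x + y \<in> A})" if "finite_borel_measure M" for M
      by (intro integrable_finite_borel_measure[OF \<mu>s, where B = "measure M UNIV"] meas that)
         (simp add: le[OF that])
    have "signed_convolution (pi_measure \<mu>s) \<nu> A
        = signed_integral (pi_measure \<mu>s) (\<lambda>x. measure P {y. x + y \<in> A} - measure N {y. x + y \<in> A})"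
      by (simp add: signed_convolution_def \<nu> shift)
    also have "\<dots> = (measure P A - measure N A)
        - (LINT x|\<mu>s. measure P {y. x + y \<in> A} - measure N {y. x + y \<in> A})"
      using signed_integral_eq[OF signed_decomp_pi[OF \<mu>s], OF borel_measurable_diff[OF meas[OF P] meas[OF N]] bdd]
        borel_measurable_diff[OF meas[OF P] meas[OF N]]
      by (simp add: integral_return)
    also have "\<dots> = (measure P A - measure N A) - (measure (\<mu>s \<star> P) A - measure (\<mu>s \<star> N) A)"
      by (simp add: int P N measure_convolution[OF \<mu>s _ A])
    finally show ?thesis by simp
  qed
  then show ?thesis
    using fin by (simp add: signed_decomp_def finite_borel_measure_add_measure measure_add_measure)
qed

text \<open>
  By induction with the preceding lemma: the passage from \<open>(P, N)\<close> to
  \<open>(P \<oplus>\<^sub>m (\<mu>s \<star> N), N \<oplus>\<^sub>m (\<mu>s \<star> P))\<close> multiplies \<open>char P - char N\<close> by \<open>1 - char \<mu>s\<close>.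
\<close>

lemma convolution_power_pi_decomp:
  assumes \<mu>s: "finite_borel_measure \<mu>s"
  shows "\<exists>P N. signed_decomp (convolution_power (pi_measure \<mu>s) k) P N
    \<and> (\<forall>t. char P t - char N t = (1 - char \<mu>s t) ^ k)"
proof (induction k)
  case 0
  have "signed_decomp (convolution_power (pi_measure \<mu>s) 0) (return borel 0) (null_measure borel)"
    using signed_decomp_measure[OF finite_borel_measure_return] by simp
  moreover have "char (return borel 0) t - char (null_measure borel) t = (1 - char \<mu>s t) ^ 0" for t
    by (simp add: char_def integral_return)
  ultimately show ?case by blast
next
  case (Suc k)
  then obtain P N where dec: "signed_decomp (convolution_power (pi_measure \<mu>s) k) P N"
    and char: "\<And>t. char P t - char N t = (1 - char \<mu>s t) ^ k" by blast
  have P: "finite_borel_measure P" and N: "finite_borel_measure N"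
    using dec by (auto simp: signed_decomp_def)
  have "char (P \<oplus>\<^sub>m (\<mu>s \<star> N)) t - char (N \<oplus>\<^sub>m (\<mu>s \<star> P)) t = (1 - char \<mu>s t) * (char P t - char N t)" for t
    using P N \<mu>s
    by (simp add: char_add_measure finite_borel_measure_convolution char_convolution algebra_simps)
  then show ?case
    using signed_decomp_pi_convolution[OF \<mu>s dec] char by fastforce
qed

text \<open>
  Integration against \<open>(\<delta>\<^sub>0 - \<mu>s) * \<nu>\<close> compares \<open>f\<close> with its average over translations by \<open>\<mu>s\<close>.
  This is the identity that makes the sum of the convolution powers telescope.
\<close>

lemma signed_integral_pi_convolution:
  assumes \<mu>s: "finite_borel_measure \<mu>s" and dec: "signed_decomp \<nu> P N"
    and f: "f \<in> borel_measurable borel" and bdd: "\<And>x. \<bar>f x\<bar> \<le> B"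
  shows "signed_integral (signed_convolution (pi_measure \<mu>s) \<nu>) f
    = signed_integral \<nu> f - signed_integral \<nu> (\<lambda>x. LINT y|\<mu>s. f (x + y))"
proof -
  interpret \<mu>s: finite_borel_measure \<mu>s by fact
  note [measurable] = f and [measurable_cong] = \<mu>s.M_is_borel
  have P: "finite_borel_measure P" and N: "finite_borel_measure N"
    using dec by (auto simp: signed_decomp_def)
  let ?g = "\<lambda>x. LINT y|\<mu>s. f (x + y)"
  have g: "?g \<in> borel_measurable borel" by measurable
  have "\<bar>?g x\<bar> \<le> (LINT y|\<mu>s. B)" for x
  proof -
    have "\<bar>?g x\<bar> \<le> (LINT y|\<mu>s. \<bar>f (x + y)\<bar>)" by (rule integral_abs_bound)
    also have "\<dots> \<le> (LINT y|\<mu>s. B)"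
      by (intro integral_mono integrable_abs integrable_finite_borel_measure[OF \<mu>s, where B = B])
         (use bdd in \<open>auto intro: order_trans[OF abs_ge_zero]\<close>)
    finally show ?thesis .
  qed
  note bddg = this
  have conv: "(LINT z|(\<mu>s \<star> M). f z) = (LINT x|M. ?g x)" if M: "finite_borel_measure M" for M
  proof -
    interpret M: finite_borel_measure M by fact
    note [measurable_cong] = M.M_is_borel
    have "(LINT z|(\<mu>s \<star> M). f z) = (LINT z|(M \<star> \<mu>s). f z)"
      using convolution_commutative[of \<mu>s M] \<mu>s.finite_measure_axioms M.finite_measure_axioms
      by (simp add: M.M_is_borel \<mu>s.M_is_borel)
    then show ?thesis
      using integral_convolution[OF M \<mu>s f, of B] bdd by simp
  qed
  show ?thesis
    using P N finite_borel_measure_convolution[OF \<mu>s P] finite_borel_measure_convolution[OF \<mu>s N]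
    by (simp add: signed_integral_eq[OF signed_decomp_pi_convolution[OF \<mu>s dec] f bdd]
        signed_integral_eq[OF dec f bdd] signed_integral_eq[OF dec g bddg]
        integral_add_measure_real[OF _ _ f bdd] conv)
qed

lemma signed_integral_sum:
  fixes \<nu> :: "nat \<Rightarrow> real set \<Rightarrow> real"
  assumes dec: "\<And>l. \<exists>P N. signed_decomp (\<nu> l) P N"
    and f: "f \<in> borel_measurable borel" and bdd: "\<And>x. \<bar>f x\<bar> \<le> B"
  shows "signed_integral (\<lambda>A. \<Sum>l\<le>m. \<nu> l A) f = (\<Sum>l\<le>m. signed_integral (\<nu> l) f)"
proof -
  have "\<exists>P N. signed_decomp (\<lambda>A. \<Sum>l\<le>m. \<nu> l A) P N \<and>
      (LINT x|P. f x) - (LINT x|N. f x) = (\<Sum>l\<le>m. signed_integral (\<nu> l) f)"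
  proof (induction m)
    case 0
    obtain P N where "signed_decomp (\<nu> 0) P N" using dec by blast
    then show ?case
      using signed_integral_eq[OF _ f bdd] by (intro exI[of _ P] exI[of _ N]) simp
  next
    case (Suc m)
    then obtain P N where PN: "signed_decomp (\<lambda>A. \<Sum>l\<le>m. \<nu> l A) P N"
      and eq: "(LINT x|P. f x) - (LINT x|N. f x) = (\<Sum>l\<le>m. signed_integral (\<nu> l) f)"
      by blast
    obtain P' N' where PN': "signed_decomp (\<nu> (Suc m)) P' N'" using dec by blast
    have fin: "finite_borel_measure P" "finite_borel_measure N"
        "finite_borel_measure P'" "finite_borel_measure N'"
      using PN PN' by (auto simp: signed_decomp_def)
    show ?case
      using PN PN' eq fin signed_integral_eq[OF PN' f bdd]
      by (intro exI[of _ "P \<oplus>\<^sub>m P'"] exI[of _ "N \<oplus>\<^sub>m N'"])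
         (auto simp: signed_decomp_def finite_borel_measure_add_measure measure_add_measure
           integral_add_measure_real[OF _ _ f bdd])
  qed
  then show ?thesis using signed_integral_eq[OF _ f bdd] by metis
qed

lemma borel_measurable_cdf:
  assumes "finite_borel_measure M" shows "cdf M \<in> borel_measurable borel"
  using finite_borel_measure.cdf_nondecreasing[OF assms]
  by (intro borel_measurable_mono) (auto simp: mono_def)

text \<open>
  The function \<open>\<lambda>x. cdf (chi \<star> \<mu>s) (\<xi> - x)\<close> is the \<open>\<mu>s\<close>-average of \<open>\<lambda>x. cdf chi (\<xi> - x)\<close>, so its
  integral against the \<open>l\<close>-th convolution power is the difference of the integrals of the latter
  function against the \<open>l\<close>-th and the next power.
\<close>

lemma deconv_fun_telescope:
  assumes chi: "finite_borel_measure chi" and \<mu>s: "finite_borel_measure \<mu>s"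
  shows "deconv_fun chi \<mu>s \<xi> m
    = cdf chi \<xi> - signed_integral (convolution_power (pi_measure \<mu>s) (Suc m)) (\<lambda>x. cdf chi (\<xi> - x))"
proof -
  interpret chi: finite_borel_measure chi by fact
  interpret \<mu>s: finite_borel_measure \<mu>s by fact
  let ?\<pi> = "convolution_power (pi_measure \<mu>s)"
  let ?f = "\<lambda>x. cdf chi (\<xi> - x)" and ?g = "\<lambda>x. cdf (chi \<star> \<mu>s) (\<xi> - x)"
  note [measurable] = borel_measurable_cdf[OF chi] borel_measurable_cdf[OF finite_borel_measure_convolution[OF chi \<mu>s]]
  have f: "?f \<in> borel_measurable borel" and g: "?g \<in> borel_measurable borel"
    by measurable
  have bddf: "\<bar>?f x\<bar> \<le> measure chi (space chi)" for x
    using chi.cdf_bounded chi.cdf_nonneg by simp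
  have bddg: "\<bar>?g x\<bar> \<le> measure (chi \<star> \<mu>s) (space (chi \<star> \<mu>s))" for x
    using finite_borel_measure_convolution[OF chi \<mu>s]
    by (simp add: finite_borel_measure.cdf_bounded finite_borel_measure.cdf_nonneg del: space_convolution)
  have dec: "\<exists>P N. signed_decomp (?\<pi> l) P N" for l
    using convolution_power_pi_decomp[OF \<mu>s] by metis
  have comm: "(chi \<star> \<mu>s) = (\<mu>s \<star> chi)"
    using convolution_commutative[of \<mu>s chi] \<mu>s.finite_measure_axioms chi.finite_measure_axioms
    by (simp add: chi.M_is_borel \<mu>s.M_is_borel)
  have gf: "?g x = (LINT y|\<mu>s. ?f (x + y))" for x
    by (simp add: comm cdf_convolution[OF \<mu>s chi] algebra_simps)
  have step: "signed_integral (?\<pi> l) ?g = signed_integral (?\<pi> l) ?f - signed_integral (?\<pi> (Suc l)) ?f" for l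
  proof -
    obtain P N where "signed_decomp (?\<pi> l) P N" using dec by blast
    from signed_integral_pi_convolution[OF \<mu>s this f bddf] show ?thesis
      by (simp add: gf)
  qed
  have "deconv_fun chi \<mu>s \<xi> m = (\<Sum>l\<le>m. signed_integral (?\<pi> l) ?g)"
    unfolding deconv_fun_def deconv_kernel_measure_def
    by (rule signed_integral_sum[OF dec g bddg])
  also have "\<dots> = signed_integral (?\<pi> 0) ?f - signed_integral (?\<pi> (Suc m)) ?f"
    unfolding step by (induction m) auto
  also have "signed_integral (?\<pi> 0) ?f = cdf chi \<xi>"
  proof -
    from signed_integral_eq[OF signed_decomp_measure[OF finite_borel_measure_return] f bddf] f show ?thesis
      by (simp add: integral_return integral_null_measure)
  qed
  finally show ?thesis .
qed

section \<open>The inversion formula of Gil-Pelaez\<close>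

text \<open>
  The factor \<open>sgn (x - \<xi>) * Si (R * \<bar>x - \<xi>\<bar>)\<close> is \<open>Si (R * (x - \<xi>))\<close>, as \<open>Si\<close> is odd; in this form
  the limit of \<open>Si\<close> at infinity determines the limit on both sides of \<open>\<xi>\<close>.
\<close>

definition sine_transform :: "real measure \<Rightarrow> real \<Rightarrow> real \<Rightarrow> real" where
  "sine_transform M \<xi> R = (LINT x|M. sgn (x - \<xi>) * Si (R * \<bar>x - \<xi>\<bar>)) / pi"

definition mid_cdf :: "real measure \<Rightarrow> real \<Rightarrow> real" where
  "mid_cdf M \<xi> = (cdf M \<xi> + left_lim (cdf M) \<xi>) / 2"

lemma left_lim_cdf:
  assumes "finite_borel_measure M"
  shows "left_lim (cdf M) \<xi> = measure M {..<\<xi>}"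
  unfolding left_lim_def
  using finite_borel_measure.cdf_at_left[OF assms] by (intro tendsto_Lim) auto

lemma borel_measurable_char:
  assumes "finite_borel_measure M"
  shows "char M \<in> borel_measurable borel"
proof -
  interpret finite_borel_measure M by fact
  note [measurable_cong] = M_is_borel
  show ?thesis unfolding char_def[abs_def] by measurable
qed

lemma norm_char_le:
  assumes "finite_borel_measure M"
  shows "norm (char M t) \<le> measure M UNIV"
proof -
  interpret finite_borel_measure M by fact
  have "norm (char M t) \<le> (LINT x|M. norm (iexp (t * x)))"
    unfolding char_def by (rule integral_norm_bound)
  then show ?thesis by (simp add: borel_UNIV del: of_real_mult)
qed

lemma borel_measurable_sgn_Si [measurable]:
  "(\<lambda>x. sgn (x - \<xi>) * Si (R * \<bar>x - \<xi>\<bar>)) \<in> borel_measurable borel"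
proof -
  have "(sgn :: real \<Rightarrow> real) \<in> borel_measurable borel"
    by (intro borel_measurable_mono) (auto simp: mono_def sgn_if)
  note [measurable] = this
  show ?thesis by measurable
qed

lemma sgn_Si_bounded:
  obtains B where "\<And>R x \<xi>. \<bar>sgn (x - \<xi>) * Si (R * \<bar>x - \<xi>\<bar>)\<bar> \<le> B"
proof -
  obtain B where B: "\<And>y. \<bar>Si y\<bar> \<le> B" using bounded_Si by blast
  have "\<bar>sgn (x - \<xi>) * Si (R * \<bar>x - \<xi>\<bar>)\<bar> \<le> B" for R x \<xi>
    using B[of "R * \<bar>x - \<xi>\<bar>"] B[of 0] by (auto simp: abs_mult sgn_if)
  then show ?thesis by (rule that)
qed

lemma integrable_sgn_Si:
  assumes "finite_borel_measure M"
  shows "integrable M (\<lambda>x. sgn (x - \<xi>) * Si (R * \<bar>x - \<xi>\<bar>))"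
proof -
  obtain B where "\<And>R x \<xi>. \<bar>sgn (x - \<xi>) * Si (R * \<bar>x - \<xi>\<bar>)\<bar> \<le> B" using sgn_Si_bounded by blast
  then show ?thesis
    by (intro integrable_finite_borel_measure[OF assms borel_measurable_sgn_Si, where B = B])
       (simp only: real_norm_def)
qed

lemma sine_transform_bounded:
  assumes M: "finite_borel_measure M"
  obtains B where "\<And>\<xi> R. \<bar>sine_transform M \<xi> R\<bar> \<le> B"
proof -
  interpret finite_borel_measure M by fact
  obtain B where B: "\<And>R x \<xi>. \<bar>sgn (x - \<xi>) * Si (R * \<bar>x - \<xi>\<bar>)\<bar> \<le> B" using sgn_Si_bounded by blast
  have "\<bar>sine_transform M \<xi> R\<bar> \<le> (LINT x|M. B) / pi" for \<xi> R
  proof -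
    have "\<bar>LINT x|M. sgn (x - \<xi>) * Si (R * \<bar>x - \<xi>\<bar>)\<bar> \<le> (LINT x|M. \<bar>sgn (x - \<xi>) * Si (R * \<bar>x - \<xi>\<bar>)\<bar>)"
      by (rule integral_abs_bound)
    also have "\<dots> \<le> (LINT x|M. B)"
      using B by (intro integral_mono integrable_abs integrable_sgn_Si[OF M]) simp_all
    finally show ?thesis by (simp add: sine_transform_def divide_right_mono)
  qed
  then show ?thesis by (rule that)
qed

text \<open>
  The sine integral is continuous and vanishes at \<open>0\<close>.  This lemma removes the truncation of the
  inversion integral at the origin.
\<close>

lemma sine_transform_tendsto_0:
  assumes M: "finite_borel_measure M"
  shows "(\<lambda>n. sine_transform M \<xi> (1 / Suc n)) \<longlonglongrightarrow> 0"
proof -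
  interpret finite_borel_measure M by fact
  note [measurable_cong] = M_is_borel
  obtain B where B: "\<And>R x \<xi>. \<bar>sgn (x - \<xi>) * Si (R * \<bar>x - \<xi>\<bar>)\<bar> \<le> B" using sgn_Si_bounded by blast
  have lim: "(\<lambda>n. sgn (x - \<xi>) * Si (1 / Suc n * \<bar>x - \<xi>\<bar>)) \<longlonglongrightarrow> 0" for x
  proof -
    have "(\<lambda>n. 1 / real (Suc n) * \<bar>x - \<xi>\<bar>) \<longlonglongrightarrow> 0 * \<bar>x - \<xi>\<bar>"
      by (intro tendsto_mult LIMSEQ_Suc[OF lim_1_over_n] tendsto_const)
    from isCont_tendsto_compose[OF isCont_Si this]
    have "(\<lambda>n. sgn (x - \<xi>) * Si (1 / Suc n * \<bar>x - \<xi>\<bar>)) \<longlonglongrightarrow> sgn (x - \<xi>) * Si (0 * \<bar>x - \<xi>\<bar>)"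
      by (intro tendsto_mult tendsto_const)
    then show ?thesis by (simp add: Si_def zero_ereal_def)
  qed
  have "(\<lambda>n. LINT x|M. sgn (x - \<xi>) * Si (1 / Suc n * \<bar>x - \<xi>\<bar>)) \<longlonglongrightarrow> (LINT x|M. 0)"
  proof (rule integral_dominated_convergence[where w = "\<lambda>_. B"])
    show "AE x in M. norm (sgn (x - \<xi>) * Si (1 / Suc n * \<bar>x - \<xi>\<bar>)) \<le> B" for n
      using B by (intro AE_I2) (simp only: real_norm_def)
  qed (use lim in auto)
  then show ?thesis unfolding sine_transform_def by (auto intro!: tendsto_eq_intros)
qed

text \<open>
  For \<open>R\<close> tending to infinity the integrand tends boundedly to \<open>pi / 2\<close> times the sign of \<open>x - \<xi>\<close>,
  and the integral of that sign is the mass above \<open>\<xi>\<close> minus the mass below \<open>\<xi>\<close>.  The atom at \<open>\<xi>\<close>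
  does not contribute, which is why the mean of both one-sided limits appears.
\<close>

lemma sine_transform_tendsto:
  assumes M: "finite_borel_measure M"
  shows "((\<lambda>R. sine_transform M \<xi> R) \<longlongrightarrow> measure M UNIV / 2 - mid_cdf M \<xi>) at_top"
proof -
  interpret finite_borel_measure M by fact
  note [measurable_cong] = M_is_borel
  obtain B where B: "\<And>R x \<xi>. \<bar>sgn (x - \<xi>) * Si (R * \<bar>x - \<xi>\<bar>)\<bar> \<le> B" using sgn_Si_bounded by blast
  have lim: "((\<lambda>R. sgn (x - \<xi>) * Si (R * \<bar>x - \<xi>\<bar>)) \<longlongrightarrow> sgn (x - \<xi>) * (pi / 2)) at_top" for x
  proof (cases "x = \<xi>")
    case False
    then have "filterlim (\<lambda>R. R * \<bar>x - \<xi>\<bar>) at_top at_top"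
      by (intro filterlim_at_top_mult_tendsto_pos[OF tendsto_const]) (auto simp: filterlim_ident)
    from filterlim_compose[OF Si_at_top this] show ?thesis
      by (intro tendsto_mult tendsto_const)
  qed simp
  have sgn: "sgn (x - \<xi>) * (pi / 2) = pi / 2 * (1 - indicator {..\<xi>} x - indicator {..<\<xi>} x)" for x
    by (auto simp: sgn_if indicator_def)
  have "((\<lambda>R. LINT x|M. sgn (x - \<xi>) * Si (R * \<bar>x - \<xi>\<bar>)) \<longlongrightarrow> (LINT x|M. sgn (x - \<xi>) * (pi / 2))) at_top"
    by (rule integral_dominated_convergence_at_top[where w = "\<lambda>_. B"])
       (use lim B in \<open>auto simp: sgn\<close>)
  moreover have "(LINT x|M. sgn (x - \<xi>) * (pi / 2)) = pi * (measure M UNIV / 2 - mid_cdf M \<xi>)"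
  proof -
    have "integrable M (indicator A :: real \<Rightarrow> real)" if "A \<in> sets borel" for A
      using that by (intro integrable_finite_borel_measure[OF M, where B = 1]) (auto simp: indicator_def)
    then show ?thesis
      unfolding sgn by (simp add: mid_cdf_def left_lim_cdf[OF M] cdf_def2 borel_UNIV field_simps)
  qed
  ultimately show ?thesis
    unfolding sine_transform_def
    by (auto intro!: tendsto_eq_intros simp: sine_transform_def)
qed

text \<open>
  The domain is symmetric and \<open>1 / t\<close> is odd, so only \<open>\<i> * sin (t * a)\<close> survives from the
  exponential; its quotient by \<open>t\<close> has the antiderivative \<open>\<lambda>t. sgn a * Si (t * \<bar>a\<bar>)\<close>.
\<close>

lemma fourier_Psi_kernel:
  assumes "0 < S" "S \<le> R"
  shows "(CLBINT t. iexp (t * a) / (2 * complex_of_real pi * \<i> * complex_of_real t)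
      * indicator {t. S \<le> \<bar>t\<bar> \<and> \<bar>t\<bar> \<le> R} t)
    = complex_of_real ((sgn a * Si (R * \<bar>a\<bar>) - sgn a * Si (S * \<bar>a\<bar>)) / pi)"
proof -
  define h where "h b t = indicator {S..R} t *\<^sub>R
    (iexp (t * b) / (2 * complex_of_real pi * \<i> * complex_of_real t))" for b t
  have int_h: "integrable lborel (h b)" for b
  proof -
    have "continuous_on {S..R} (\<lambda>t. iexp (t * b) / (2 * complex_of_real pi * \<i> * complex_of_real t))"
      using assms by (intro continuous_intros) auto
    from borel_integrable_atLeastAtMost'[OF this] show ?thesis
      unfolding h_def[abs_def] set_integrable_def .
  qed
  have refl: "integrable lborel (\<lambda>t. h b (- t))" "integral\<^sup>L lborel (\<lambda>t. h b (- t)) = integral\<^sup>L lborel (h b)" for b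
    using lborel_integrable_real_affine[OF int_h, of "-1" b 0]
      lborel_integral_real_affine[of "-1" "h b" 0] by simp_all
  \<comment> \<open>The part over the negative half-line is reflected to the positive one.\<close>
  have "(CLBINT t. iexp (t * a) / (2 * complex_of_real pi * \<i> * complex_of_real t)
      * indicator {t. S \<le> \<bar>t\<bar> \<and> \<bar>t\<bar> \<le> R} t) = (CLBINT t. h a t - h (- a) (- t))"
    using assms by (intro Bochner_Integration.integral_cong) (auto simp: h_def indicator_def)
  also have "\<dots> = (CLBINT t. h a t - h (- a) t)"
    by (simp add: int_h refl)
  also have "\<dots> = (CLBINT t. complex_of_real (sin (t * a) / t * indicator {S..R} t / pi))"
    by (intro Bochner_Integration.integral_cong)
       (auto simp: h_def indicator_def complex_eq_iff Re_exp Im_exp Re_divide Im_divide field_simps power2_eq_square)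
  also have "\<dots> = complex_of_real ((LBINT t. sin (t * a) / t * indicator {S..R} t) / pi)"
    by (simp only: integral_complex_of_real integral_divide_zero)
  also have "(LBINT t. sin (t * a) / t * indicator {S..R} t) = sgn a * Si (R * \<bar>a\<bar>) - sgn a * Si (S * \<bar>a\<bar>)"
  proof (rule integral_FTC_Icc_real[OF \<open>S \<le> R\<close>])
    fix t assume t: "S \<le> t" "t \<le> R"
    have "((\<lambda>t. sgn a * Si (t * \<bar>a\<bar>)) has_real_derivative sgn a * (sinc (t * \<bar>a\<bar>) * \<bar>a\<bar>)) (at t)"
      by (intro DERIV_cmult DERIV_chain2[OF DERIV_Si]) (auto intro!: derivative_eq_intros)
    also have "sgn a * (sinc (t * \<bar>a\<bar>) * \<bar>a\<bar>) = sin (t * a) / t"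
      using t assms by (auto simp: sgn_if abs_if)
    finally show "((\<lambda>t. sgn a * Si (t * \<bar>a\<bar>)) has_real_derivative sin (t * a) / t) (at t)" .
    show "isCont (\<lambda>t. sin (t * a) / t) t"
      using t assms by (intro continuous_intros) auto
  qed
  finally show ?thesis .
qed

lemma borel_measurable_Psi:
  assumes "finite_borel_measure M"
  shows "Psi M S R \<in> borel_measurable borel"
proof -
  note [measurable] = borel_measurable_char[OF assms]
  show ?thesis unfolding Psi_def[abs_def] by measurable
qed

lemma integrable_fourier_Psi:
  assumes M: "finite_borel_measure M" and "0 < S"
  shows "integrable lborel (\<lambda>t. iexp (s * t) * Psi M S R t)"
proof (rule integrableI_bounded_set[where A = "{-R..R}" and B = "measure M UNIV / (2 * pi * S)"])
  show "(\<lambda>t. iexp (s * t) * Psi M S R t) \<in> borel_measurable lborel"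
    using borel_measurable_Psi[OF M] by simp
  show "AE t in lborel. t \<in> {-R..R} \<longrightarrow> norm (iexp (s * t) * Psi M S R t) \<le> measure M UNIV / (2 * pi * S)"
    using \<open>0 < S\<close> norm_char_le[OF M]
    by (intro AE_I2)
       (auto simp: Psi_def norm_mult norm_divide indicator_def abs_mult intro!: frac_le mult_mono simp del: of_real_mult)
qed (auto simp: Psi_def indicator_def emeasure_lborel_Icc_eq)

text \<open>
  Away from \<open>t = 0\<close> the kernel is bounded, so that Fubini applies and the integral over \<open>t\<close> can be
  evaluated first.  This is where the truncation at \<open>S > 0\<close> is essential.
\<close>

lemma fourier_Psi_eq_sine_transform:
  assumes M: "finite_borel_measure M" and "0 < S" "S \<le> R"
  shows "fourier (Psi M S R) (- \<xi>) = complex_of_real (sine_transform M \<xi> R - sine_transform M \<xi> S)"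
proof -
  interpret finite_borel_measure M by fact
  interpret P: pair_sigma_finite lborel M ..
  note [measurable_cong] = M_is_borel
  let ?k = "\<lambda>t x. iexp (t * (x - \<xi>)) / (2 * complex_of_real pi * \<i> * complex_of_real t)
      * indicator {t. S \<le> \<bar>t\<bar> \<and> \<bar>t\<bar> \<le> R} t"
  have "fourier (Psi M S R) (- \<xi>) = (CLBINT t. (CLINT x|M. ?k t x))"
    unfolding fourier_def
  proof (rule Bochner_Integration.integral_cong[OF HOL.refl])
    fix t
    have "(CLINT x|M. ?k t x) = (CLINT x|M. iexp (t * x) * (iexp (- \<xi> * t)
        / (2 * complex_of_real pi * \<i> * complex_of_real t) * indicator {t. S \<le> \<bar>t\<bar> \<and> \<bar>t\<bar> \<le> R} t))"
      by (intro Bochner_Integration.integral_cong)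
         (auto simp: exp_diff exp_minus right_diff_distrib field_simps)
    also have "\<dots> = iexp (- \<xi> * t) * Psi M S R t"
      by (simp add: Psi_def char_def)
    finally show "iexp (- \<xi> * t) * Psi M S R t = (CLINT x|M. ?k t x)" ..
  qed
  also have "\<dots> = (CLINT x|M. (CLBINT t. ?k t x))"
  proof (rule P.Fubini_integral[symmetric])
    show "integrable (lborel \<Otimes>\<^sub>M M) (\<lambda>(t, x). ?k t x)"
    proof (rule integrableI_bounded_set[where A = "{-R..R} \<times> UNIV" and B = "1 / (2 * pi * S)"])
      show "emeasure (lborel \<Otimes>\<^sub>M M) ({-R..R} \<times> UNIV) < \<infinity>"
        using assms
        by (subst emeasure_pair_measure_Times) (auto simp: ennreal_mult_less_top emeasure_eq_measure)
      show "AE z in lborel \<Otimes>\<^sub>M M. z \<in> {-R..R} \<times> UNIV \<longrightarrow> norm (case z of (t, x) \<Rightarrow> ?k t x) \<le> 1 / (2 * pi * S)"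
        using \<open>0 < S\<close>
        by (intro AE_I2)
           (auto simp: norm_mult norm_divide indicator_def abs_mult intro!: frac_le mult_mono simp del: of_real_mult of_real_diff)
    qed (auto simp: indicator_def intro!: AE_I2)
  qed
  also have "\<dots> = (CLINT x|M. complex_of_real ((sgn (x - \<xi>) * Si (R * \<bar>x - \<xi>\<bar>) - sgn (x - \<xi>) * Si (S * \<bar>x - \<xi>\<bar>)) / pi))"
    by (simp only: fourier_Psi_kernel[OF assms(2,3)])
  also have "\<dots> = complex_of_real (sine_transform M \<xi> R - sine_transform M \<xi> S)"
  proof -
    show ?thesis
      using integrable_sgn_Si[OF M]
      by (simp add: sine_transform_def diff_divide_distrib del: of_real_mult of_real_divide of_real_diff)
  qed
  finally show ?thesis .
qed

text \<open>
  The inversion formula for a finite measure, with the principal value at \<open>0\<close> expressed through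
  \<open>sine_transform M \<xi> S\<close>; it also shows that the improper integral exists.
\<close>

lemma fourier_Psi_inf_tendsto:
  assumes M: "finite_borel_measure M" and "0 < S"
  shows "((\<lambda>R. fourier (Psi M S R) (- \<xi>)) \<longlongrightarrow> fourier_Psi_inf M S (- \<xi>)) at_top"
    and "fourier_Psi_inf M S (- \<xi>)
      = complex_of_real (measure M UNIV / 2 - mid_cdf M \<xi> - sine_transform M \<xi> S)"
proof -
  have "((\<lambda>R. complex_of_real (sine_transform M \<xi> R - sine_transform M \<xi> S)) \<longlongrightarrow>
      complex_of_real (measure M UNIV / 2 - mid_cdf M \<xi> - sine_transform M \<xi> S)) at_top"
    by (intro tendsto_intros sine_transform_tendsto[OF M])
  moreover have "\<forall>\<^sub>F R in at_top. complex_of_real (sine_transform M \<xi> R - sine_transform M \<xi> S)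
      = fourier (Psi M S R) (- \<xi>)"
    by (rule eventually_mono[OF eventually_ge_at_top[of S]])
       (simp only: fourier_Psi_eq_sine_transform[OF assms])
  ultimately have *: "((\<lambda>R. fourier (Psi M S R) (- \<xi>)) \<longlongrightarrow>
      complex_of_real (measure M UNIV / 2 - mid_cdf M \<xi> - sine_transform M \<xi> S)) at_top"
    by (rule Lim_transform_eventually)
  then show "fourier_Psi_inf M S (- \<xi>)
      = complex_of_real (measure M UNIV / 2 - mid_cdf M \<xi> - sine_transform M \<xi> S)"
    unfolding fourier_Psi_inf_def by (intro tendsto_Lim) auto
  with * show "((\<lambda>R. fourier (Psi M S R) (- \<xi>)) \<longlongrightarrow> fourier_Psi_inf M S (- \<xi>)) at_top"
    by simp
qed

section \<open>Inversion for differences of measures\<close>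

text \<open>
  Both truncations of the inversion formula can be removed for \<open>P - N\<close>.  Outside of \<open>[-T, T]\<close> the
  factor \<open>q\<close> is \<open>1\<close>, which leaves the improper integral of \<open>chi\<close>.  Inside, \<open>q t / t\<close> is integrable,
  so the principal value at \<open>0\<close> is an ordinary integral.  The condition \<open>q 0 = 0\<close> says that \<open>P\<close>
  and \<open>N\<close> have the same total mass, so that the mass terms of the inversion formula cancel.
\<close>

lemma mid_cdf_difference_inversion:
  fixes q :: "real \<Rightarrow> complex"
  assumes chi: "finite_borel_measure chi" and P: "finite_borel_measure P" and N: "finite_borel_measure N"
    and "0 < T"
    and char: "\<And>t. char P t - char N t = char chi t * q t"
    and q: "q \<in> borel_measurable borel"
    and q0: "q 0 = 0" and q_outside: "\<And>t. \<bar>t\<bar> > T \<Longrightarrow> q t = 1"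
    and int_q: "integrable lborel (\<lambda>t. q t / complex_of_real t * indicator {-T..T} t)"
  shows "complex_of_real (mid_cdf P \<xi> - mid_cdf N \<xi>) = - fourier_Psi_inf chi T (- \<xi>)
    - fourier (\<lambda>t. char chi t * q t / (2 * complex_of_real pi * \<i> * complex_of_real t)
        * indicator {-T..T} t) (- \<xi>)"
proof -
  note [measurable] = borel_measurable_char[OF chi] q
  let ?\<Theta> = "\<lambda>t. char chi t * q t / (2 * complex_of_real pi * \<i> * complex_of_real t) * indicator {-T..T} t"
  have Psi_diff: "Psi P S R t - Psi N S R t
      = char chi t * q t / (2 * complex_of_real pi * \<i> * complex_of_real t)
        * indicator {t. S \<le> \<bar>t\<bar> \<and> \<bar>t\<bar> \<le> R} t" for S R t
    unfolding Psi_def char[symmetric] by (simp add: diff_divide_distrib left_diff_distrib)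
  have fourier_diff: "fourier (Psi P S R) (- \<xi>) - fourier (Psi N S R) (- \<xi>)
      = (CLBINT t. iexp (- \<xi> * t) * (Psi P S R t - Psi N S R t))" if "0 < S" for S R
    unfolding fourier_def right_diff_distrib
    by (intro Bochner_Integration.integral_diff[symmetric] integrable_fourier_Psi P N that)
  have mass: "measure P UNIV = measure N UNIV"
  proof -
    have *: "char M 0 = complex_of_real (measure M UNIV)" if "finite_borel_measure M" for M
      using finite_borel_measure.borel_UNIV[OF that] by (simp add: char_def scaleR_conv_of_real)
    show ?thesis using char[of 0] *[OF P] *[OF N] by (simp add: q0)
  qed
  \<comment> \<open>At the boundary points \<open>t = T\<close> and \<open>t = -T\<close> the factor \<open>q\<close> need not be \<open>1\<close>; they form a null set.\<close>
  have outer: "fourier (Psi P T R) (- \<xi>) - fourier (Psi N T R) (- \<xi>) = fourier (Psi chi T R) (- \<xi>)" for R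
    unfolding fourier_diff[OF \<open>0 < T\<close>] unfolding fourier_def
  proof (rule integral_cong_AE)
    have "AE t in lborel. t \<noteq> T" "AE t in lborel. t \<noteq> -T"
      by (simp_all add: AE_lborel_singleton)
    then show "AE t in lborel. iexp (- \<xi> * t) * (Psi P T R t - Psi N T R t) = iexp (- \<xi> * t) * Psi chi T R t"
    proof eventually_elim
      case (elim t)
      then have "T < \<bar>t\<bar>" if "T \<le> \<bar>t\<bar>" using that by (auto simp: abs_if split: if_splits)
      then show ?case
        unfolding Psi_diff by (auto simp: Psi_def indicator_def q_outside)
    qed
  qed (use borel_measurable_Psi[OF P] borel_measurable_Psi[OF N] borel_measurable_Psi[OF chi] in simp_all)
  have Psi_inf: "fourier_Psi_inf chi T (- \<xi>) = fourier_Psi_inf P T (- \<xi>) - fourier_Psi_inf N T (- \<xi>)"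
  proof (rule tendsto_unique[OF _ fourier_Psi_inf_tendsto(1)[OF chi \<open>0 < T\<close>]])
    show "((\<lambda>R. fourier (Psi chi T R) (- \<xi>)) \<longlongrightarrow> fourier_Psi_inf P T (- \<xi>) - fourier_Psi_inf N T (- \<xi>)) at_top"
      unfolding outer[symmetric]
      by (intro tendsto_diff fourier_Psi_inf_tendsto(1) P N \<open>0 < T\<close>)
  qed simp
  \<comment> \<open>The truncation at \<open>?\<epsilon> n\<close> tends to \<open>0\<close>.  At \<open>t = 0\<close> all integrands vanish by division by zero.\<close>
  let ?\<epsilon> = "\<lambda>n. 1 / real (Suc n)"
  have "(\<lambda>n. CLBINT t. iexp (- \<xi> * t) * (Psi P (?\<epsilon> n) T t - Psi N (?\<epsilon> n) T t)) \<longlonglongrightarrow> fourier ?\<Theta> (- \<xi>)"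
    unfolding fourier_def
  proof (rule integral_dominated_convergence[where
        w = "\<lambda>t. measure chi UNIV * norm (q t / complex_of_real t * indicator {-T..T} t)"])
    show "AE t in lborel. (\<lambda>n. iexp (- \<xi> * t) * (Psi P (?\<epsilon> n) T t - Psi N (?\<epsilon> n) T t)) \<longlonglongrightarrow> iexp (- \<xi> * t) * ?\<Theta> t"
    proof (intro AE_I2 tendsto_mult tendsto_const tendsto_eventually)
      fix t
      show "\<forall>\<^sub>F n in sequentially. Psi P (?\<epsilon> n) T t - Psi N (?\<epsilon> n) T t = ?\<Theta> t"
      proof (cases "t = 0")
        case False
        then have "\<forall>\<^sub>F n in sequentially. ?\<epsilon> n < \<bar>t\<bar>"
          by (intro order_tendstoD[OF LIMSEQ_Suc[OF lim_1_over_n]]) auto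
        then show ?thesis
          unfolding Psi_diff by eventually_elim (auto simp: indicator_def)
      qed (simp add: Psi_diff)
    qed
    show "AE t in lborel. norm (iexp (- \<xi> * t) * (Psi P (?\<epsilon> n) T t - Psi N (?\<epsilon> n) T t))
        \<le> measure chi UNIV * norm (q t / complex_of_real t * indicator {-T..T} t)" for n
    proof (rule AE_I2)
      fix t
      have "norm (char chi t) * norm (q t) / (2 * pi * \<bar>t\<bar>) \<le> measure chi UNIV * norm (q t) / (1 * \<bar>t\<bar>)"
        if "t \<noteq> 0"
        using that norm_char_le[OF chi, of t] pi_ge_two
        by (intro frac_le mult_mono mult_right_mono) auto
      then show "norm (iexp (- \<xi> * t) * (Psi P (?\<epsilon> n) T t - Psi N (?\<epsilon> n) T t))
        \<le> measure chi UNIV * norm (q t / complex_of_real t * indicator {-T..T} t)"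
        unfolding Psi_diff
        by (cases "t = 0") (auto simp: norm_mult norm_divide indicator_def simp del: of_real_mult)
    qed
    show "integrable lborel (\<lambda>t. measure chi UNIV * norm (q t / complex_of_real t * indicator {-T..T} t))"
      by (intro integrable_mult_right integrable_norm int_q)
  qed (unfold Psi_diff, measurable)
  then have lim1: "(\<lambda>n. fourier (Psi P (?\<epsilon> n) T) (- \<xi>) - fourier (Psi N (?\<epsilon> n) T) (- \<xi>)) \<longlonglongrightarrow> fourier ?\<Theta> (- \<xi>)"
    by (simp add: fourier_diff del: of_real_mult)
  have "(\<lambda>n. fourier (Psi M (?\<epsilon> n) T) (- \<xi>)) \<longlonglongrightarrow> complex_of_real (sine_transform M \<xi> T - 0)"
    if M: "finite_borel_measure M" for M
  proof (rule Lim_transform_eventually)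
    show "(\<lambda>n. complex_of_real (sine_transform M \<xi> T - sine_transform M \<xi> (?\<epsilon> n)))
        \<longlonglongrightarrow> complex_of_real (sine_transform M \<xi> T - 0)"
      by (intro tendsto_intros sine_transform_tendsto_0[OF M])
    have "\<forall>\<^sub>F n in sequentially. ?\<epsilon> n < T"
      using \<open>0 < T\<close> by (intro order_tendstoD[OF LIMSEQ_Suc[OF lim_1_over_n]]) auto
    then show "\<forall>\<^sub>F n in sequentially. complex_of_real (sine_transform M \<xi> T - sine_transform M \<xi> (?\<epsilon> n))
        = fourier (Psi M (?\<epsilon> n) T) (- \<xi>)"
      by eventually_elim (rule fourier_Psi_eq_sine_transform[OF M, symmetric], auto)
  qed
  from tendsto_diff[OF this[OF P] this[OF N]]
  have "fourier ?\<Theta> (- \<xi>) = complex_of_real (sine_transform P \<xi> T - sine_transform N \<xi> T)"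
    using LIMSEQ_unique[OF lim1] by simp
  then show ?thesis
    unfolding Psi_inf fourier_Psi_inf_tendsto(2)[OF P \<open>0 < T\<close>] fourier_Psi_inf_tendsto(2)[OF N \<open>0 < T\<close>]
    by (simp add: mass)
qed

section \<open>The limit of the deconvolution function\<close>

text \<open>
  \<open>P\<close> and \<open>N\<close> are the convolutions with \<open>chi\<close> of the positive and the negative part of the convolution
  power of order \<open>Suc m\<close>.  Left limits are taken in each distribution function separately.
\<close>

lemma mid_deconv_fun:
  assumes chi: "finite_borel_measure chi" and \<mu>s: "finite_borel_measure \<mu>s"
  obtains P N where "finite_borel_measure P" "finite_borel_measure N"
    "\<And>t. char P t - char N t = char chi t * (1 - char \<mu>s t) ^ Suc m"
    "\<And>\<xi>. (deconv_fun chi \<mu>s \<xi> m + left_lim (\<lambda>x. deconv_fun chi \<mu>s x m) \<xi>) / 2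
      = mid_cdf chi \<xi> - (mid_cdf P \<xi> - mid_cdf N \<xi>)"
proof -
  obtain P N where dec: "signed_decomp (convolution_power (pi_measure \<mu>s) (Suc m)) P N"
    and char: "\<And>t. char P t - char N t = (1 - char \<mu>s t) ^ Suc m"
    using convolution_power_pi_decomp[OF \<mu>s, of "Suc m"] by blast
  have P: "finite_borel_measure P" and N: "finite_borel_measure N"
    using dec by (auto simp: signed_decomp_def)
  note PC = finite_borel_measure_convolution[OF P chi] and NC = finite_borel_measure_convolution[OF N chi]
  interpret chi: finite_borel_measure chi by fact
  note [measurable] = borel_measurable_cdf[OF chi]
  have D: "deconv_fun chi \<mu>s \<xi> m = cdf chi \<xi> - (cdf (P \<star> chi) \<xi> - cdf (N \<star> chi) \<xi>)" for \<xi>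
    unfolding deconv_fun_telescope[OF chi \<mu>s] cdf_convolution[OF P chi] cdf_convolution[OF N chi]
    by (subst signed_integral_eq[OF dec, where B = "measure chi (space chi)"])
       (use chi.cdf_bounded chi.cdf_nonneg in auto)
  have L: "left_lim (\<lambda>x. deconv_fun chi \<mu>s x m) \<xi> = left_lim (cdf chi) \<xi>
      - (left_lim (cdf (P \<star> chi)) \<xi> - left_lim (cdf (N \<star> chi)) \<xi>)" for \<xi>
    unfolding left_lim_cdf[OF chi] left_lim_cdf[OF PC] left_lim_cdf[OF NC] unfolding left_lim_def D
    by (intro tendsto_Lim tendsto_diff finite_borel_measure.cdf_at_left chi PC NC) auto
  have "(deconv_fun chi \<mu>s \<xi> m + left_lim (\<lambda>x. deconv_fun chi \<mu>s x m) \<xi>) / 2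
      = mid_cdf chi \<xi> - (mid_cdf (P \<star> chi) \<xi> - mid_cdf (N \<star> chi) \<xi>)" for \<xi>
    unfolding L by (simp add: D mid_cdf_def add_divide_distrib diff_divide_distrib)
  moreover have "char (P \<star> chi) t - char (N \<star> chi) t = char chi t * (1 - char \<mu>s t) ^ Suc m" for t
    by (simp add: char_convolution P N chi char[symmetric] algebra_simps del: power_Suc)
  ultimately show ?thesis using that PC NC by blast
qed

text \<open>
  On \<open>[0, T]\<close> the quotient \<open>p t / t\<close> is controlled near \<open>0\<close> by the hypothesis and beyond \<open>\<tau>\<close> by
  \<open>1 / \<tau>\<close>; evenness of \<open>p\<close> transfers the bound to the negative half-line by reflection.
\<close>

lemma integrable_over_id_symmetric:
  fixes p :: "real \<Rightarrow> real"
  assumes [measurable]: "p \<in> borel_measurable borel"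
    and p: "\<And>t. 0 \<le> p t" "\<And>t. p t \<le> 1" and even: "\<And>t. p (- t) = p t"
    and "0 < \<tau>" and fin: "(\<integral>\<^sup>+t\<in>{0<..\<tau>}. ennreal (p t / t) \<partial>lborel) < \<infinity>"
  shows "integrable lborel (\<lambda>t. p t / t * indicator {-T..T} t)"
proof -
  define G where "G t = p t / t * indicator {0<..\<tau>} t + indicator {0..T} t / \<tau>" for t
  have "integrable lborel (\<lambda>t. p t / t * indicator {0<..\<tau>} t)"
  proof (rule integrableI_nonneg)
    have "(\<integral>\<^sup>+t. ennreal (p t / t * indicator {0<..\<tau>} t) \<partial>lborel) = (\<integral>\<^sup>+t\<in>{0<..\<tau>}. ennreal (p t / t) \<partial>lborel)"
      by (intro nn_integral_cong) (auto simp: indicator_def)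
    then show "(\<integral>\<^sup>+t. ennreal (p t / t * indicator {0<..\<tau>} t) \<partial>lborel) < \<infinity>" using fin by simp
  qed (use p in \<open>auto simp: indicator_def\<close>)
  then have G: "integrable lborel G"
    unfolding G_def[abs_def] by (intro Bochner_Integration.integrable_add integrable_divide) (auto simp: emeasure_lborel_Icc_eq)
  have "integrable lborel (\<lambda>t. G (- t))"
    using lborel_integrable_real_affine[OF G, of "-1" 0] by simp
  with G have "integrable lborel (\<lambda>t. G t + G (- t))" by simp
  then show ?thesis
  proof (rule Bochner_Integration.integrable_bound)
    have le: "p t / t \<le> G t" "0 \<le> G t" if "0 < t" "t \<le> T" for t
      using that p[of t] \<open>0 < \<tau>\<close> by (auto simp: G_def indicator_def not_le intro!: frac_le)
    have nonneg: "0 \<le> G t" for t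
      using p[of t] \<open>0 < \<tau>\<close> by (auto simp: G_def indicator_def)
    have "\<bar>p t / t * indicator {-T..T} t\<bar> \<le> G t + G (- t)" for t
    proof (cases "t = 0 \<or> \<bar>t\<bar> > T")
      case True
      then show ?thesis using nonneg[of t] nonneg[of "- t"] by (auto simp: indicator_def)
    next
      case False
      then have "p t / \<bar>t\<bar> \<le> G \<bar>t\<bar>"
        using le(1)[of "\<bar>t\<bar>"] even[of t] by (auto simp: abs_if)
      moreover have "G \<bar>t\<bar> \<le> G t + G (- t)" using nonneg[of t] nonneg[of "-t"] by (auto simp: abs_if)
      ultimately show ?thesis using p(1)[of t] False by (auto simp: indicator_def abs_mult)
    qed
    then show "AE t in lborel. norm (p t / t * indicator {-T..T} t) \<le> norm (G t + G (- t))"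
      using nonneg by (intro AE_I2) (simp add: add_nonneg_nonneg)
  qed measurable
qed

theorem theorem6p2:
  fixes chi \<mu> \<mu>s :: "real measure" and T :: real
  assumes "real_distribution chi" and "real_distribution \<mu>"
    and "symmetrization \<mu>s \<mu>"
    and "\<exists>\<tau>>0. (\<integral>\<^sup>+t\<in>{0<..\<tau>}. ennreal ((1 - Re (char \<mu>s t)) / t) \<partial>lborel) < \<infinity>"
    and "T > 0" and "\<And>t. \<bar>t\<bar> > T \<Longrightarrow> char \<mu>s t = 0"
  shows "(\<forall>\<xi>. (\<lambda>m. complex_of_real
            ((deconv_fun chi \<mu>s \<xi> m + left_lim (\<lambda>x. deconv_fun chi \<mu>s x m) \<xi>) / 2))
          \<longlonglongrightarrow> complex_of_real ((cdf chi \<xi> + left_lim (cdf chi) \<xi>) / 2)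
              + fourier (Theta chi \<mu> T) (-\<xi>) + fourier_Psi_inf chi T (-\<xi>))
       \<and> (\<forall>K. compact K \<longrightarrow>
          bounded ((\<lambda>\<xi>. fourier (Theta chi \<mu> T) (-\<xi>)) ` K) \<and>
          bounded ((\<lambda>\<xi>. fourier_Psi_inf chi T (-\<xi>)) ` K))"
proof -
  interpret chi: real_distribution chi by fact
  have \<mu>s_prob: "real_distribution \<mu>s" and even: "\<And>t. char \<mu>s (- t) = char \<mu>s t"
    and char_real: "\<And>t. \<exists>r. char \<mu>s t = complex_of_real r \<and> 0 \<le> r \<and> r \<le> 1"
    and zeros: "char_zeros \<mu>s = char_zeros \<mu>"
    using \<open>symmetrization \<mu>s \<mu>\<close> by (auto simp: symmetrization_def)
  interpret \<mu>s: real_distribution \<mu>s by fact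
  note chi = chi.finite_borel_measure_M and \<mu>s = \<mu>s.finite_borel_measure_M
  define p where "p t = 1 - Re (char \<mu>s t)" for t
  have p: "0 \<le> p t" "p t \<le> 1" and char_p: "1 - char \<mu>s t = complex_of_real (p t)" for t
    using char_real[of t] by (auto simp: p_def)
  have [measurable]: "p \<in> borel_measurable borel" unfolding p_def[abs_def] by measurable
  have zero_iff: "ereal t \<in> char_zeros \<mu> \<longleftrightarrow> p t = 1" for t
    unfolding zeros[symmetric] using char_p[of t] by (auto simp: char_zeros_def)
  obtain \<tau> where "0 < \<tau>" "(\<integral>\<^sup>+t\<in>{0<..\<tau>}. ennreal (p t / t) \<partial>lborel) < \<infinity>"
    using assms(4) by (auto simp: p_def)
  then have int_p: "integrable lborel (\<lambda>t. p t / t * indicator {-T..T} t)"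
    using p even by (intro integrable_over_id_symmetric[of p \<tau>]) (auto simp: p_def)
  define w where "w t = norm (p t / t * indicator {-T..T} t)" for t
  have int_w: "integrable lborel w" unfolding w_def[abs_def] by (intro integrable_norm int_p)
  define q where "q m t = complex_of_real (p t ^ Suc m)" for m t
  define \<Theta> where "\<Theta> m t = char chi t * q m t / (2 * complex_of_real pi * \<i> * complex_of_real t)
      * indicator {-T..T} t" for m t
  have q_le: "norm (q m t) \<le> p t" for m t
    using p[of t] power_decreasing[of 1 "Suc m" "p t"] by (simp add: q_def norm_power del: of_real_power power_Suc)
  \<comment> \<open>One majorant serves for all \<open>\<Theta> m\<close> and for their limit.\<close>
  have kernel_le: "norm (char chi t * c / (2 * complex_of_real pi * \<i> * complex_of_real t) * indicator {-T..T} t) \<le> w t"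
    if "norm c \<le> p t" for c t
  proof -
    have "norm (char chi t) * norm c / (2 * pi * \<bar>t\<bar>) \<le> 1 * p t / (1 * \<bar>t\<bar>)" if "t \<noteq> 0"
      using that chi.cmod_char_le_1[of t] \<open>norm c \<le> p t\<close> pi_ge_two p[of t]
      by (intro frac_le mult_mono mult_right_mono) auto
    then show ?thesis
      using p(1)[of t] by (cases "t = 0") (auto simp: w_def norm_mult norm_divide indicator_def abs_mult)
  qed
  have Theta_le: "norm (Theta chi \<mu> T t) \<le> w t" for t
    using kernel_le[of "if p t = 1 then 1 else 0" t] p[of t]
    by (auto simp: Theta_def indicator_def zero_iff split: if_splits)
  have Theta_meas: "Theta chi \<mu> T \<in> borel_measurable borel"
  proof -
    have "Theta chi \<mu> T = (\<lambda>t. char chi t / (2 * complex_of_real pi * \<i> * complex_of_real t)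
        * indicator {t. t \<in> {-T..T} \<and> p t = 1} t)"
      by (simp add: Theta_def[abs_def] zero_iff)
    then show ?thesis by simp
  qed
  \<comment> \<open>For finite \<open>m\<close> the asserted identity holds exactly, with \<open>\<Theta> m\<close> in place of its limit.\<close>
  have key: "complex_of_real ((deconv_fun chi \<mu>s \<xi> m + left_lim (\<lambda>x. deconv_fun chi \<mu>s x m) \<xi>) / 2)
      = complex_of_real (mid_cdf chi \<xi>) + fourier (\<Theta> m) (- \<xi>) + fourier_Psi_inf chi T (- \<xi>)" for m \<xi>
  proof -
    obtain P N where PN: "finite_borel_measure P" "finite_borel_measure N"
      and char: "\<And>t. char P t - char N t = char chi t * (1 - char \<mu>s t) ^ Suc m"
      and mid: "(deconv_fun chi \<mu>s \<xi> m + left_lim (\<lambda>x. deconv_fun chi \<mu>s x m) \<xi>) / 2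
        = mid_cdf chi \<xi> - (mid_cdf P \<xi> - mid_cdf N \<xi>)"
      using mid_deconv_fun[OF chi \<mu>s, of m] by metis
    have "complex_of_real (mid_cdf P \<xi> - mid_cdf N \<xi>) = - fourier_Psi_inf chi T (- \<xi>) - fourier (\<Theta> m) (- \<xi>)"
      unfolding \<Theta>_def[abs_def]
    proof (rule mid_cdf_difference_inversion[OF chi PN \<open>0 < T\<close>])
      show "char P t - char N t = char chi t * q m t" for t
        unfolding char char_p q_def by simp
      show "q m \<in> borel_measurable borel" unfolding q_def[abs_def] by measurable
      show "q m 0 = 0" using \<mu>s.char_zero by (simp add: q_def p_def)
      show "q m t = 1" if "T < \<bar>t\<bar>" for t
        using assms(6)[OF that] by (simp add: q_def p_def)
      show "integrable lborel (\<lambda>t. q m t / complex_of_real t * indicator {-T..T} t)"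
      proof (rule Bochner_Integration.integrable_bound[OF int_w])
        show "AE t in lborel. norm (q m t / complex_of_real t * indicator {-T..T} t) \<le> norm (w t)"
          using q_le p by (intro AE_I2) (auto simp: w_def indicator_def norm_divide intro!: divide_right_mono)
      qed (unfold q_def, measurable)
    qed
    then show ?thesis unfolding mid of_real_diff[of "mid_cdf chi \<xi>"] by simp
  qed
  have conv: "(\<lambda>m. fourier (\<Theta> m) (- \<xi>)) \<longlonglongrightarrow> fourier (Theta chi \<mu> T) (- \<xi>)" for \<xi>
    unfolding fourier_def
  proof (rule integral_dominated_convergence[where w = w])
    show "AE t in lborel. (\<lambda>m. iexp (- \<xi> * t) * \<Theta> m t) \<longlonglongrightarrow> iexp (- \<xi> * t) * Theta chi \<mu> T t"
    proof (intro AE_I2 tendsto_mult tendsto_const)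
      fix t
      have "(\<lambda>m. q m t) \<longlonglongrightarrow> (if p t = 1 then 1 else 0)"
      proof (cases "p t = 1")
        case False
        then have "(\<lambda>m. p t ^ Suc m) \<longlonglongrightarrow> 0"
          using p[of t] by (intro LIMSEQ_Suc[OF LIMSEQ_power_zero]) auto
        then have "(\<lambda>m. complex_of_real (p t ^ Suc m)) \<longlonglongrightarrow> complex_of_real 0"
          by (rule tendsto_of_real)
        then show ?thesis using False by (simp add: q_def)
      qed (simp add: q_def)
      then have "(\<lambda>m. \<Theta> m t) \<longlonglongrightarrow> char chi t * (if p t = 1 then 1 else 0)
          / (2 * complex_of_real pi * \<i> * complex_of_real t) * indicator {-T..T} t"
        unfolding \<Theta>_def divide_inverse by (intro tendsto_mult tendsto_const)
      also have "char chi t * (if p t = 1 then 1 else 0)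
          / (2 * complex_of_real pi * \<i> * complex_of_real t) * indicator {-T..T} t = Theta chi \<mu> T t"
        by (auto simp: Theta_def indicator_def zero_iff)
      finally show "(\<lambda>m. \<Theta> m t) \<longlonglongrightarrow> Theta chi \<mu> T t" .
    qed
    show "AE t in lborel. norm (iexp (- \<xi> * t) * \<Theta> m t) \<le> w t" for m
    proof (rule AE_I2)
      fix t
      have "norm (iexp (- \<xi> * t) * \<Theta> m t) = norm (\<Theta> m t)"
        by (simp add: norm_mult del: of_real_mult)
      then show "norm (iexp (- \<xi> * t) * \<Theta> m t) \<le> w t"
        using kernel_le[OF q_le, of t m] by (simp only: \<Theta>_def)
    qed
    show "(\<lambda>t. iexp (- \<xi> * t) * Theta chi \<mu> T t) \<in> borel_measurable lborel"
      using Theta_meas by simp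
    show "(\<lambda>t. iexp (- \<xi> * t) * \<Theta> m t) \<in> borel_measurable lborel" for m
      unfolding \<Theta>_def q_def by measurable
  qed (rule int_w)
  have Theta_bdd: "norm (fourier (Theta chi \<mu> T) (- \<xi>)) \<le> integral\<^sup>L lborel w" for \<xi>
    unfolding fourier_def
  proof (rule Bochner_Integration.integral_norm_bound_integral[OF _ int_w])
    show le: "norm (iexp (- \<xi> * t) * Theta chi \<mu> T t) \<le> w t" for t
      using Theta_le[of t] by (simp add: norm_mult del: of_real_mult)
    show "integrable lborel (\<lambda>t. iexp (- \<xi> * t) * Theta chi \<mu> T t)"
    proof (rule Bochner_Integration.integrable_bound[OF int_w])
      show "AE t in lborel. norm (iexp (- \<xi> * t) * Theta chi \<mu> T t) \<le> norm (w t)"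
        by (intro AE_I2) (simp only: real_norm_def, rule order_trans[OF le abs_ge_self])
    qed (use Theta_meas in simp)
  qed
  obtain B where B: "\<And>\<xi> R. \<bar>sine_transform chi \<xi> R\<bar> \<le> B" using sine_transform_bounded[OF chi] by blast
  have Psi_bdd: "norm (fourier_Psi_inf chi T (- \<xi>)) \<le> 3 / 2 + B" for \<xi>
  proof -
    have "0 \<le> mid_cdf chi \<xi>" "mid_cdf chi \<xi> \<le> 1"
      using chi.cdf_bounded_prob[of \<xi>] chi.cdf_nonneg[of \<xi>] chi.prob_le_1[of "{..<\<xi>}"]
        measure_nonneg[of chi "{..<\<xi>}"]
      by (simp_all add: mid_cdf_def left_lim_cdf[OF chi] del: chi.prob_le_1)
    moreover have "measure chi UNIV = 1" using chi.prob_space by simp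
    ultimately show ?thesis
      unfolding fourier_Psi_inf_tendsto(2)[OF chi \<open>0 < T\<close>] norm_of_real
      using B[of \<xi> T] by (auto simp: abs_le_iff)
  qed
  show ?thesis
  proof (intro conjI allI impI)
    show "(\<lambda>m. complex_of_real ((deconv_fun chi \<mu>s \<xi> m + left_lim (\<lambda>x. deconv_fun chi \<mu>s x m) \<xi>) / 2))
        \<longlonglongrightarrow> complex_of_real ((cdf chi \<xi> + left_lim (cdf chi) \<xi>) / 2)
          + fourier (Theta chi \<mu> T) (- \<xi>) + fourier_Psi_inf chi T (- \<xi>)" for \<xi>
      unfolding key mid_cdf_def by (intro tendsto_intros conv)
  qed (use Theta_bdd Psi_bdd in \<open>auto intro!: boundedI\<close>)
qed

end
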